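(* Let $A$ be a $d\times d$ Hurwitz stable Metzler matrix (i.e. $\eta(A)<0$), let $\boldsymbol e\in\mathbb R^d$ be the vector of all ones and $E$ the $d\times d$ matrix of all ones. Then all Metzler matrices $X$ that satisfy $$X < A - \frac{E}{\langle A^{-1}\boldsymbol e,\boldsymbol e\rangle}$$ are Hurwitz stable. Moreover, the matrix $A - \frac{E}{\langle A^{-1}\boldsymbol e,\boldsymbol e\rangle}$ is the closest Hurwitz unstable Metzler matrix to $A$ in the max-norm, i.e. it is a solution of the problem $$\min\{\|X-A\|_{\max}\ :\ X \text{ Metzler},\ \eta(X)=0\},$$ and its distance to $A$ is equal to $$\tau_* = \frac{1}{\sum_{i,j}|a'_{ij}|},$$ where $a'_{ij}$ are the entries of the matrix $A^{-1}$.
   Context: All matrices are real $d\times d$. A matrix is Metzler if all its off-diagonal entries are non-negative. The spectral abscissa $\eta(A)$ is the largest real part of the eigenvalues of $A$. A Metzler matrix $A$ is (strongly) Hurwitz stable if $\eta(A)<0$, and weakly Hurwitz unstable if $\eta(A)\geqslant 0$. The relation $X<Y$ between matrices means that every entry of $Y-X$ is strictly positive. The max-norm is $\|X\|_{\max}=\max_{i,j}|x_{ij}|$. A Hurwitz stable Metzler matrix is invertible. *)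

theory Defs
  imports "Jordan_Normal_Form.Spectral_Radius" "Jordan_Normal_Form.Gauss_Jordan_Elimination"
begin

definition metzler :: "real mat \<Rightarrow> bool" where
  "metzler A \<longleftrightarrow> square_mat A \<and>
     (\<forall>i < dim_row A. \<forall>j < dim_row A. i \<noteq> j \<longrightarrow> 0 \<le> A $$ (i, j))"

(* The eigenvalues are the complex ones.  For square matrices of positive dimension the
   spectrum is finite and nonempty, so that Max is meaningful. *)
definition spectral_abscissa :: "real mat \<Rightarrow> real" where
  "spectral_abscissa A = Max (Re ` spectrum (map_mat complex_of_real A))"

definition hurwitz_stable :: "real mat \<Rightarrow> bool" where
  "hurwitz_stable A \<longleftrightarrow> spectral_abscissa A < 0"

definition weakly_hurwitz_unstable :: "real mat \<Rightarrow> bool" where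
  "weakly_hurwitz_unstable A \<longleftrightarrow> spectral_abscissa A \<ge> 0"

(* Strict inequality in every entry.  The library's order < on matrices is only the strict
   part of the entrywise order, i.e. X \<le> Y and X \<noteq> Y. *)
definition entrywise_less :: "real mat \<Rightarrow> real mat \<Rightarrow> bool" where
  "entrywise_less X Y \<longleftrightarrow> dim_row X = dim_row Y \<and> dim_col X = dim_col Y \<and>
     (\<forall>i < dim_row Y. \<forall>j < dim_col Y. X $$ (i, j) < Y $$ (i, j))"

definition max_norm :: "real mat \<Rightarrow> real" where
  "max_norm X = Max (abs ` elements_mat X)"

definition ones_vec :: "nat \<Rightarrow> real vec" where
  "ones_vec d = vec d (\<lambda>_. 1)"

definition ones_mat :: "nat \<Rightarrow> real mat" where
  "ones_mat d = mat d d (\<lambda>_. 1)"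

(* The inverse matrix; meaningful for invertible square matrices. *)
definition inv_mat :: "real mat \<Rightarrow> real mat" where
  "inv_mat A = the (mat_inverse A)"

end

theory Submission
  imports Defs
begin

text \<open>Stability makes \<open>A\<inverse>\<close> entrywise nonpositive, so \<open>x = -A\<inverse>e\<close> is strictly positive, and with
  \<open>t = 1 / \<langle>x, e\<rangle>\<close> the matrix \<open>M = A + t E\<close> satisfies \<open>M x = -e + e = 0\<close>. By Gershgorin's theorem
  with weights \<open>x\<close>, a Metzler matrix \<open>X\<close> is stable as soon as \<open>X x < 0\<close>. This holds for every \<open>X\<close>
  strictly below \<open>M\<close>, in particular whenever all entries of \<open>X - A\<close> are less than \<open>t\<close> in absolute
  value, while \<open>M\<close> itself has the eigenvalue \<open>0\<close> and none with positive real part.\<close>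

section \<open>Spectra in coordinates and a weighted Gershgorin bound\<close>

lemma mult_mat_vec_index_sum:
  assumes "A \<in> carrier_mat n m" "v \<in> carrier_vec m" "i < n"
  shows "(A *\<^sub>v v) $ i = (\<Sum>j<m. A $$ (i, j) * v $ j)"
  using assms by (auto simp: scalar_prod_def atLeast0LessThan)

text \<open>With eigenvectors as plain functions, shifting or scaling a matrix and weighting
  coordinates become manipulations of finite sums.\<close>

lemma spectrum_of_real_iff:
  assumes A: "A \<in> carrier_mat n n"
  shows "l \<in> spectrum (map_mat complex_of_real A) \<longleftrightarrow>
    (\<exists>v. (\<exists>i<n. v i \<noteq> 0) \<and> (\<forall>i<n. (\<Sum>j<n. of_real (A $$ (i, j)) * v j) = l * v i))"
    (is "_ \<longleftrightarrow> ?R")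
proof -
  let ?A = "map_mat complex_of_real A"
  have cA: "?A \<in> carrier_mat n n" using A by simp
  have Av: "(?A *\<^sub>v v) $ i = (\<Sum>j<n. of_real (A $$ (i, j)) * v $ j)"
    if "v \<in> carrier_vec n" "i < n" for v i
    using mult_mat_vec_index_sum[OF cA that] A that by simp
  show ?thesis
  proof
    assume "l \<in> spectrum ?A"
    then obtain v where v: "v \<in> carrier_vec n" "v \<noteq> 0\<^sub>v n" "?A *\<^sub>v v = l \<cdot>\<^sub>v v"
      using A by (auto simp: spectrum_def eigenvalue_def eigenvector_def)
    have "\<exists>i<n. v $ i \<noteq> 0" using v(1,2) by (metis carrier_vecD eq_vecI index_zero_vec)
    moreover have "(\<Sum>j<n. of_real (A $$ (i, j)) * v $ j) = l * v $ i" if "i < n" for i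
      using Av[OF v(1) that] v(1,3) that by simp
    ultimately show ?R by blast
  next
    assume ?R
    then obtain v where v: "\<exists>i<n. v i \<noteq> 0"
      "\<And>i. i < n \<Longrightarrow> (\<Sum>j<n. of_real (A $$ (i, j)) * v j) = l * v i" by blast
    have "?A *\<^sub>v vec n v = l \<cdot>\<^sub>v vec n v"
    proof (rule eq_vecI)
      fix i assume "i < dim_vec (l \<cdot>\<^sub>v vec n v)"
      then have "i < n" by simp
      then show "(?A *\<^sub>v vec n v) $ i = (l \<cdot>\<^sub>v vec n v) $ i"
        using Av[of "vec n v" i] v(2)[of i] by simp
    qed (use A in simp)
    moreover have "vec n v \<noteq> 0\<^sub>v n" using v(1) by (metis index_vec index_zero_vec(1))
    ultimately show "l \<in> spectrum ?A"
      using A by (auto simp: spectrum_def eigenvalue_def eigenvector_def intro!: exI[of _ "vec n v"])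
  qed
qed

lemma Re_le_spectral_abscissa:
  assumes "A \<in> carrier_mat n n" "l \<in> spectrum (map_mat complex_of_real A)"
  shows "Re l \<le> spectral_abscissa A"
  unfolding spectral_abscissa_def
  using card_finite_spectrum(1)[of "map_mat complex_of_real A" n] assms by auto

lemma spectral_abscissa_attained:
  assumes "A \<in> carrier_mat n n" "n > 0"
  obtains l where "l \<in> spectrum (map_mat complex_of_real A)" "Re l = spectral_abscissa A"
proof -
  have c: "map_mat complex_of_real A \<in> carrier_mat n n" using assms by simp
  have "spectral_abscissa A \<in> Re ` spectrum (map_mat complex_of_real A)"
    unfolding spectral_abscissa_def
    using card_finite_spectrum(1)[OF c] spectrum_non_empty[OF c assms(2)] by (intro Max_in) auto
  then show ?thesis using that by force
qed

text \<open>Gershgorin's disc theorem after conjugation by the diagonal matrix of the weights \<open>x\<close>.\<close>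

lemma metzler_weighted_gershgorin:
  assumes X: "X \<in> carrier_mat n n" "metzler X"
    and x: "\<And>i. i < n \<Longrightarrow> 0 < x i"
    and l: "l \<in> spectrum (map_mat complex_of_real X)"
  obtains i where "i < n" "Re l * x i \<le> (\<Sum>j<n. X $$ (i, j) * x j)"
proof -
  obtain v k where k: "k < n" "v k \<noteq> 0"
    and v: "\<And>i. i < n \<Longrightarrow> (\<Sum>j<n. of_real (X $$ (i, j)) * v j) = l * v i"
    using l unfolding spectrum_of_real_iff[OF X(1)] by blast
  \<comment> \<open>Maximizing these weighted moduli selects the Gershgorin row: there every
    \<open>norm (v j)\<close> is at most \<open>q i * x j\<close>, with equality for
    \<open>j = i\<close>.\<close>
  define q where "q i = norm (v i) / x i" for i
  obtain i where i: "i < n" and qmax: "\<And>j. j < n \<Longrightarrow> q j \<le> q i"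
  proof -
    have "Max (q ` {..<n}) \<in> q ` {..<n}" using k by (intro Max_in) auto
    then obtain i where "i < n" "q i = Max (q ` {..<n})" by auto
    then show ?thesis using that[of i] by simp
  qed
  have "0 < q k" using k x by (simp add: q_def)
  then have q: "0 < q i" using qmax[OF k(1)] by linarith
  have vle: "norm (v j) \<le> q i * x j" if "j < n" for j
    using qmax[OF that] x[OF that] by (simp add: q_def field_simps)
  have vi: "norm (v i) = q i * x i" using x[OF i] by (simp add: q_def)
  have offdiag: "0 \<le> X $$ (i, j)" if "j \<in> {..<n} - {i}" for j
    using X i that by (auto simp: metzler_def)
  have "(l - of_real (X $$ (i, i))) * v i = (\<Sum>j\<in>{..<n} - {i}. of_real (X $$ (i, j)) * v j)"
    using v[OF i] sum.remove[of "{..<n}" i "\<lambda>j. of_real (X $$ (i, j)) * v j"] i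
    by (simp add: algebra_simps)
  then have "norm (l - of_real (X $$ (i, i))) * (q i * x i)
      = norm (\<Sum>j\<in>{..<n} - {i}. of_real (X $$ (i, j)) * v j)"
    using vi by (metis norm_mult)
  also have "\<dots> \<le> (\<Sum>j\<in>{..<n} - {i}. X $$ (i, j) * (q i * x j))"
    using offdiag vle by (intro sum_norm_le) (auto simp: norm_mult intro!: mult_left_mono)
  also have "\<dots> = q i * (\<Sum>j\<in>{..<n} - {i}. X $$ (i, j) * x j)"
    by (simp add: sum_distrib_left mult_ac)
  finally have "norm (l - of_real (X $$ (i, i))) * x i \<le> (\<Sum>j\<in>{..<n} - {i}. X $$ (i, j) * x j)"
    using q by (simp add: mult.left_commute)
  \<comment> \<open>Passing from the modulus to the real part keeps the sign of the diagonal entry,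
    so it rejoins the row sum without an absolute value.\<close>
  moreover have "(Re l - X $$ (i, i)) * x i \<le> norm (l - of_real (X $$ (i, i))) * x i"
    using x[OF i] complex_Re_le_cmod[of "l - of_real (X $$ (i, i))"] by (intro mult_right_mono) auto
  ultimately have "Re l * x i \<le> (\<Sum>j<n. X $$ (i, j) * x j)"
    using sum.remove[of "{..<n}" i "\<lambda>j. X $$ (i, j) * x j"] i by (simp add: algebra_simps)
  with i show ?thesis by (rule that)
qed

section \<open>Inverse positivity of stable Metzler matrices\<close>

text \<open>Since |l + c|^2 = |l|^2 + 2 c Re l + c^2, a point with Re l < 0 satisfies |l + c| < c
  for all large c. Finiteness of \<open>S\<close> gives a common c and leaves room for a radius b <
  c.\<close>

lemma finite_left_half_plane_shift:
  assumes "finite S" "\<And>l. l \<in> S \<Longrightarrow> Re l < 0"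
  obtains b c :: real where "0 < b" "b < c" "lo \<le> c"
    "\<And>l. l \<in> S \<Longrightarrow> norm (l + of_real c) < b"
proof -
  have "\<forall>\<^sub>F c in at_top. norm (l + of_real c) < c" if l: "l \<in> S" for l
  proof -
    have "norm (l + of_real c) < c" if c: "c > max 0 ((norm l)\<^sup>2 / (- 2 * Re l))" for c
    proof -
      have "(norm l)\<^sup>2 < c * (- 2 * Re l)"
        using c assms(2)[OF l] by (subst pos_divide_less_eq[symmetric]) auto
      then have "(norm (l + of_real c))\<^sup>2 < c\<^sup>2"
        unfolding cmod_power2 by (simp add: power2_sum algebra_simps)
      then show ?thesis by (rule power2_less_imp_less) (use c in linarith)
    qed
    then show ?thesis unfolding eventually_at_top_dense by blast
  qed
  then have "\<forall>\<^sub>F c in at_top. \<forall>l\<in>S. norm (l + of_real c) < c"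
    using assms(1) by (intro eventually_ball_finite) auto
  then obtain N where N: "\<And>c l. N \<le> c \<Longrightarrow> l \<in> S \<Longrightarrow> norm (l + of_real c) < c"
    unfolding eventually_at_top_linorder by blast
  define c where "c = max N (max lo 1)"
  have c: "lo \<le> c" "0 < c" "\<And>l. l \<in> S \<Longrightarrow> norm (l + of_real c) < c"
    using N[of c] by (auto simp: c_def)
  \<comment> \<open>The inserted 0 keeps the maximum defined for empty \<open>S\<close> and makes
    the midpoint of \<open>m\<close> and \<open>c\<close> positive.\<close>
  define m where "m = Max (insert 0 ((\<lambda>l. norm (l + of_real c)) ` S))"
  have m: "0 \<le> m" "\<And>l. l \<in> S \<Longrightarrow> norm (l + of_real c) \<le> m"
    using assms(1) by (auto simp: m_def)
  have "m < c" using assms(1) c by (auto simp: m_def)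
  moreover have "norm (l + of_real c) < (m + c) / 2" if "l \<in> S" for l
    using m(2)[OF that] \<open>m < c\<close> by simp
  ultimately show ?thesis
    using m(1) c(1,2) by (intro that[of "(m + c) / 2" c]) simp_all
qed

text \<open>Inverse positivity. For \<open>P = (A + c I) / b \<ge> 0\<close> with \<open>b < c\<close>, the hypothesis on \<open>y\<close> says
  \<open>y \<ge> (b / c) P y\<close>, hence \<open>y \<ge> (b / c)\<^sup>n P\<^sup>n y\<close> for all \<open>n\<close>. Choosing \<open>c\<close> large and \<open>b\<close> close to
  \<open>c\<close> makes the spectral radius of \<open>P\<close> less than one, so that the powers of \<open>P\<close> stay bounded and
  the right-hand side tends to zero.\<close>

lemma stable_metzler_nonneg:
  assumes A: "A \<in> carrier_mat d d" "metzler A" "hurwitz_stable A"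
    and y: "\<And>i. i < d \<Longrightarrow> (\<Sum>j<d. A $$ (i, j) * y j) \<le> 0"
    and i: "i < d"
  shows "0 \<le> y i"
proof -
  have d: "d > 0" using i by simp
  let ?S = "spectrum (map_mat complex_of_real A)"
  have fin: "finite ?S" using A(1) card_finite_spectrum(1)[of "map_mat complex_of_real A" d] by simp
  have neg: "Re l < 0" if "l \<in> ?S" for l
    using Re_le_spectral_abscissa[OF A(1) that] A(3) by (simp add: hurwitz_stable_def)
  \<comment> \<open>The lower bound on \<open>c\<close> makes the diagonal of A + c I
    nonnegative.\<close>
  obtain b c where bc: "0 < b" "b < c" "Max ((\<lambda>i. - A $$ (i, i)) ` {..<d}) \<le> c"
    and lb: "\<And>l. l \<in> ?S \<Longrightarrow> norm (l + of_real c) < b"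
    using finite_left_half_plane_shift[OF fin neg, where lo = "Max ((\<lambda>i. - A $$ (i, i)) ` {..<d})"] by blast
  define P where "P = mat d d (\<lambda>(i, j). (A $$ (i, j) + (if i = j then c else 0)) / b)"
  let ?P = "map_mat complex_of_real P"
  have P: "P \<in> carrier_mat d d" by (simp add: P_def)
  have cP: "?P \<in> carrier_mat d d" using P by simp
  have Pnn: "0 \<le> P $$ (i, j)" if ij: "i < d" "j < d" for i j
  proof -
    have "- A $$ (i, i) \<le> Max ((\<lambda>i. - A $$ (i, i)) ` {..<d})" using ij by (intro Max_ge) auto
    then have "0 \<le> A $$ (i, i) + c" using bc(3) by linarith
    then show ?thesis using A(1,2) bc(1) ij by (auto simp: P_def metzler_def)
  qed
  have Psum: "(\<Sum>j<d. P $$ (i, j) * y j) = ((\<Sum>j<d. A $$ (i, j) * y j) + c * y i) / b"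
    if "i < d" for i
  proof -
    have "(\<Sum>j<d. P $$ (i, j) * y j)
      = (\<Sum>j<d. A $$ (i, j) * y j / b + (if i = j then c * y j / b else 0))"
      using that bc by (intro sum.cong) (auto simp: P_def field_simps)
    then show ?thesis using that
      by (simp add: sum.distrib sum_divide_distrib add_divide_distrib)
  qed
  \<comment> \<open>An eigenvalue m of \<open>P\<close> gives the eigenvalue b m - c of
    \<open>A\<close>, and adding c to it leaves b m, of modulus less than b by
    \<open>lb\<close>.\<close>
  have "norm m < 1" if m: "m \<in> spectrum ?P" for m
  proof -
    obtain v where v: "\<exists>i<d. v i \<noteq> 0"
      "\<And>i. i < d \<Longrightarrow> (\<Sum>j<d. of_real (P $$ (i, j)) * v j) = m * v i"
      using m unfolding spectrum_of_real_iff[OF P] by blast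
    have "(\<Sum>j<d. of_real (A $$ (i, j)) * v j) = (of_real b * m - of_real c) * v i" if "i < d" for i
    proof -
      have "(\<Sum>j<d. of_real (A $$ (i, j)) * v j)
        = (\<Sum>j<d. of_real b * (of_real (P $$ (i, j)) * v j) - (if i = j then of_real c * v j else 0))"
        using that bc by (intro sum.cong) (auto simp: P_def field_simps)
      also have "\<dots> = of_real b * (\<Sum>j<d. of_real (P $$ (i, j)) * v j) - of_real c * v i"
        using that by (simp add: sum_subtractf sum_distrib_left)
      finally show ?thesis using v(2)[OF that] by (simp add: algebra_simps)
    qed
    then have "of_real b * m - of_real c \<in> ?S"
      unfolding spectrum_of_real_iff[OF A(1)] using v(1) by blast
    from lb[OF this] bc show ?thesis by (simp add: norm_mult)
  qed
  then have "spectral_radius ?P < 1" using spectral_radius_mem_max(1)[OF cP d] by auto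
  from spectral_radius_jnf_norm_bound_less_1_upper_triangular[OF cP this]
  obtain C where C: "\<And>k. norm_bound (?P ^\<^sub>m k) C" by blast
  have Pk: "P ^\<^sub>m k \<in> carrier_mat d d" for k using P by (rule pow_carrier_mat)
  have Pkbound: "\<bar>(P ^\<^sub>m k) $$ (i, j)\<bar> \<le> C" if "i < d" "j < d" for i j k
  proof -
    have "?P ^\<^sub>m k = map_mat complex_of_real (P ^\<^sub>m k)"
      by (rule of_real_hom.mat_hom_pow[OF P, symmetric])
    then have "norm (complex_of_real ((P ^\<^sub>m k) $$ (i, j))) \<le> C"
      using C[of k] P that by (simp add: norm_bound_def)
    then show ?thesis by simp
  qed
  have PSuc: "(P ^\<^sub>m Suc k) $$ (i, j) = (\<Sum>l<d. (P ^\<^sub>m k) $$ (i, l) * P $$ (l, j))"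
    if "i < d" "j < d" for i j k
    using that P Pk[of k] by (simp add: scalar_prod_def atLeast0LessThan)
  have Pknn: "0 \<le> (P ^\<^sub>m k) $$ (i, j)" if "i < d" "j < d" for i j k
    using that
  proof (induction k arbitrary: i j)
    case (Suc k)
    then show ?case unfolding PSuc[OF Suc.prems] using Pnn by (intro sum_nonneg mult_nonneg_nonneg) auto
  qed (use P in auto)
  define r where "r = b / c"
  have r: "0 < r" "r < 1" using bc by (auto simp: r_def)
  \<comment> \<open>By \<open>Psum\<close>, r P y = (A y) / c + y, and A y is nonpositive.\<close>
  have step: "r * (\<Sum>j<d. P $$ (i, j) * y j) \<le> y i" if "i < d" for i
  proof -
    have "r * (\<Sum>j<d. P $$ (i, j) * y j) = (\<Sum>j<d. A $$ (i, j) * y j) / c + y i"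
      using bc unfolding Psum[OF that] r_def by (simp add: field_simps)
    then show ?thesis using y[OF that] bc by (simp add: divide_nonpos_pos)
  qed
  \<comment> \<open>Nonnegativity of the powers of \<open>P\<close> allows \<open>step\<close> to be
    applied inside the sum.\<close>
  have iter: "r ^ k * (\<Sum>j<d. (P ^\<^sub>m k) $$ (i, j) * y j) \<le> y i" for k
  proof (induction k)
    case 0
    have "(\<Sum>j<d. (P ^\<^sub>m 0) $$ (i, j) * y j) = (\<Sum>j<d. if i = j then y j else 0)"
      using P i by (intro sum.cong) auto
    then show ?case using i by simp
  next
    case (Suc k)
    have "(\<Sum>j<d. (P ^\<^sub>m Suc k) $$ (i, j) * y j)
      = (\<Sum>j<d. \<Sum>l<d. (P ^\<^sub>m k) $$ (i, l) * P $$ (l, j) * y j)"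
      using i by (intro sum.cong) (auto simp: PSuc sum_distrib_right simp del: pow_mat.simps)
    also have "\<dots> = (\<Sum>l<d. (P ^\<^sub>m k) $$ (i, l) * (\<Sum>j<d. P $$ (l, j) * y j))"
      by (subst sum.swap) (simp add: sum_distrib_left mult_ac)
    finally have "r * (\<Sum>j<d. (P ^\<^sub>m Suc k) $$ (i, j) * y j)
      = (\<Sum>l<d. (P ^\<^sub>m k) $$ (i, l) * (r * (\<Sum>j<d. P $$ (l, j) * y j)))"
      by (simp add: sum_distrib_left mult_ac)
    also have "\<dots> \<le> (\<Sum>l<d. (P ^\<^sub>m k) $$ (i, l) * y l)"
      using Pknn i step by (intro sum_mono mult_left_mono) auto
    finally have "r ^ k * (r * (\<Sum>j<d. (P ^\<^sub>m Suc k) $$ (i, j) * y j))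
      \<le> r ^ k * (\<Sum>l<d. (P ^\<^sub>m k) $$ (i, l) * y l)"
      using r by (intro mult_left_mono) auto
    with Suc show ?case by (simp add: mult_ac)
  qed
  have low: "- (r ^ k * (\<Sum>j<d. C * \<bar>y j\<bar>)) \<le> y i" for k
  proof -
    have "\<bar>\<Sum>j<d. (P ^\<^sub>m k) $$ (i, j) * y j\<bar> \<le> (\<Sum>j<d. C * \<bar>y j\<bar>)"
      using Pkbound i by (intro order_trans[OF sum_abs] sum_mono) (auto simp: abs_mult intro!: mult_right_mono)
    then have "r ^ k * - (\<Sum>j<d. C * \<bar>y j\<bar>) \<le> r ^ k * (\<Sum>j<d. (P ^\<^sub>m k) $$ (i, j) * y j)"
      using r by (intro mult_left_mono) auto
    with iter[of k] show ?thesis by simp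
  qed
  have "(\<lambda>k. - (r ^ k * (\<Sum>j<d. C * \<bar>y j\<bar>))) \<longlonglongrightarrow> - (0 * (\<Sum>j<d. C * \<bar>y j\<bar>))"
    using r by (intro tendsto_intros LIMSEQ_realpow_zero) auto
  from LIMSEQ_le_const2[OF this, of "y i"] show ?thesis using low by simp
qed

section \<open>Invertibility and the max-norm\<close>

text \<open>A singular matrix has the eigenvalue 0, whose real part would exceed the negative
  spectral abscissa. Hence \<open>mat_inverse\<close> returns a value and \<open>the\<close> in
  \<open>inv_mat\<close> is harmless.\<close>

lemma stable_inv_mat:
  assumes A: "A \<in> carrier_mat d d" "hurwitz_stable A"
  shows "inv_mat A \<in> carrier_mat d d" "A * inv_mat A = 1\<^sub>m d"
proof -
  have "det A \<noteq> 0"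
  proof
    assume "det A = 0"
    then obtain v where v: "v \<in> carrier_vec d" "v \<noteq> 0\<^sub>v d" "A *\<^sub>v v = 0\<^sub>v d"
      using det_0_iff_vec_prod_zero_field[OF A(1)] by blast
    have "0\<^sub>v d = 0 \<cdot>\<^sub>v v" using v(1) by (intro eq_vecI) auto
    with v(3) have "A *\<^sub>v v = 0 \<cdot>\<^sub>v v" by (rule trans)
    then have "eigenvector A v 0"
      using v(1,2) A(1) unfolding eigenvector_def by (metis carrier_matD(1))
    then have "eigenvalue A 0" by (auto simp only: eigenvalue_def)
    then have "0 \<in> spectrum (map_mat complex_of_real A)"
      using of_real_hom.eigenvalue_hom[OF A(1)] by (fastforce simp: spectrum_def)
    from Re_le_spectral_abscissa[OF A(1) this] A(2) show False by (simp add: hurwitz_stable_def)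
  qed
  then have "A \<in> Units (ring_mat TYPE(real) d undefined)"
    by (rule det_non_zero_imp_unit[OF A(1)])
  then obtain B where "mat_inverse A = Some B"
    using mat_inverse(1)[OF A(1)] by (metis option.exhaust)
  with mat_inverse(2)[OF A(1) this]
  show "inv_mat A \<in> carrier_mat d d" "A * inv_mat A = 1\<^sub>m d" by (auto simp: inv_mat_def)
qed

lemma max_norm_less_iff:
  assumes "X \<in> carrier_mat n m" "n > 0" "m > 0"
  shows "max_norm X < c \<longleftrightarrow> (\<forall>i<n. \<forall>j<m. \<bar>X $$ (i, j)\<bar> < c)"
proof -
  have e: "elements_mat X = (\<lambda>(i, j). X $$ (i, j)) ` ({..<n} \<times> {..<m})"
    using assms by (auto simp: elements_mat_def)
  have "max_norm X < c \<longleftrightarrow> (\<forall>a\<in>abs ` elements_mat X. a < c)"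
    unfolding max_norm_def using assms by (intro Max_less_iff) (auto simp: e)
  then show ?thesis by (auto simp: e)
qed

section \<open>The extremal matrix and its distance to \<open>A\<close>\<close>

theorem theorem2:
  fixes d :: nat and A :: "real mat"
  assumes "d \<ge> 1"
    and "A \<in> carrier_mat d d"
    and "metzler A"
    and "hurwitz_stable A"
  shows "let M = A - (1 / ((inv_mat A *\<^sub>v ones_vec d) \<bullet> ones_vec d)) \<cdot>\<^sub>m ones_mat d
    in (\<forall>X \<in> carrier_mat d d. metzler X \<and> entrywise_less X M \<longrightarrow> hurwitz_stable X)
     \<and> is_arg_min (\<lambda>X. max_norm (X - A))
         (\<lambda>X. X \<in> carrier_mat d d \<and> metzler X \<and> weakly_hurwitz_unstable X) M
     \<and> is_arg_min (\<lambda>X. max_norm (X - A))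
         (\<lambda>X. X \<in> carrier_mat d d \<and> metzler X \<and> spectral_abscissa X = 0) M
     \<and> max_norm (M - A) = 1 / (\<Sum>i<d. \<Sum>j<d. \<bar>inv_mat A $$ (i, j)\<bar>)"
proof -
  define M where "M = A - (1 / ((inv_mat A *\<^sub>v ones_vec d) \<bullet> ones_vec d)) \<cdot>\<^sub>m ones_mat d"
  define B where "B = inv_mat A"
  have d: "d > 0" and A: "A \<in> carrier_mat d d" "metzler A" "hurwitz_stable A" using assms by auto
  have B: "B \<in> carrier_mat d d" "A * B = 1\<^sub>m d" using stable_inv_mat[OF A(1,3)] by (auto simp: B_def)
  have AB: "(\<Sum>k<d. A $$ (i, k) * B $$ (k, j)) = (if i = j then 1 else 0)" if "i < d" "j < d" for i j
  proof -
    have "(\<Sum>k<d. A $$ (i, k) * B $$ (k, j)) = (A * B) $$ (i, j)"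
      using that A B(1) by (simp add: scalar_prod_def atLeast0LessThan)
    then show ?thesis using that B(2) by simp
  qed
  \<comment> \<open>Inverse positivity is applied to column j of -B, which \<open>A\<close> maps to
    minus the j-th unit vector.\<close>
  have Bnp: "B $$ (i, j) \<le> 0" if "i < d" "j < d" for i j
  proof -
    have "0 \<le> - B $$ (i, j)"
      by (rule stable_metzler_nonneg[OF A _ that(1), where y = "\<lambda>i. - B $$ (i, j)"])
        (use AB that in \<open>simp add: sum_negf\<close>)
    then show ?thesis by simp
  qed
  define x where "x i = - (\<Sum>j<d. B $$ (i, j))" for i
  have Ax: "(\<Sum>j<d. A $$ (i, j) * x j) = -1" if "i < d" for i
  proof -
    have "(\<Sum>j<d. A $$ (i, j) * x j) = - (\<Sum>k<d. \<Sum>j<d. A $$ (i, j) * B $$ (j, k))"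
      by (subst sum.swap) (simp add: x_def sum_distrib_left sum_negf)
    then show ?thesis using that by (simp add: AB)
  qed
  have xnn: "0 \<le> x i" if "i < d" for i
    using Bnp that by (auto simp: x_def intro: sum_nonpos)
  \<comment> \<open>If x i = 0, the diagonal term of row i of A x vanishes and the other terms are
    nonnegative, contradicting the value -1.\<close>
  have xpos: "0 < x i" if i: "i < d" for i
  proof (rule ccontr)
    assume "\<not> 0 < x i"
    then have x0: "x i = 0" using xnn[OF i] by simp
    have "0 \<le> (\<Sum>j<d. A $$ (i, j) * x j)"
    proof (rule sum_nonneg)
      fix j assume "j \<in> {..<d}"
      then show "0 \<le> A $$ (i, j) * x j"
        using A(1,2) x0 xnn[of j] i by (cases "i = j") (auto simp: metzler_def)
    qed
    with Ax[OF i] show False by simp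
  qed
  define t where "t = 1 / (\<Sum>i<d. x i)"
  have sx: "0 < (\<Sum>i<d. x i)" using xpos d by (intro sum_pos) auto
  then have t: "0 < t" by (simp add: t_def)
  have "(B *\<^sub>v ones_vec d) \<bullet> ones_vec d = (\<Sum>i<d. - x i)"
    using B(1) by (auto simp: scalar_prod_def ones_vec_def x_def atLeast0LessThan intro!: sum.cong)
  then have tB: "1 / ((B *\<^sub>v ones_vec d) \<bullet> ones_vec d) = - t" by (simp add: t_def sum_negf)
  \<comment> \<open>All entries of \<open>B\<close> are nonpositive, so the sum of the x i is the
    sum of their absolute values.\<close>
  have tabs: "t = 1 / (\<Sum>i<d. \<Sum>j<d. \<bar>B $$ (i, j)\<bar>)"
    unfolding t_def x_def sum_negf[symmetric]
    using Bnp by (intro arg_cong2[where f = "(/)"] sum.cong) auto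
  have M: "M \<in> carrier_mat d d" using A(1) by (simp add: M_def ones_mat_def minus_carrier_mat)
  have Mij: "M $$ (i, j) = A $$ (i, j) + t" if "i < d" "j < d" for i j
    using that A(1) tB by (simp add: M_def ones_mat_def B_def)
  have Mx: "(\<Sum>j<d. M $$ (i, j) * x j) = 0" if i: "i < d" for i
  proof -
    have "(\<Sum>j<d. M $$ (i, j) * x j) = (\<Sum>j<d. A $$ (i, j) * x j) + t * (\<Sum>j<d. x j)"
      using i by (simp add: Mij algebra_simps sum.distrib sum_distrib_left)
    then show ?thesis using Ax[OF i] sx by (simp add: t_def)
  qed
  have Mmetz: "metzler M"
    using A(1,2) M t by (auto simp: metzler_def Mij intro: add_nonneg_nonneg)
  have stab: "hurwitz_stable X"
    if X: "X \<in> carrier_mat d d" "metzler X" "\<And>i j. i < d \<Longrightarrow> j < d \<Longrightarrow> X $$ (i, j) < M $$ (i, j)" for X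
  proof -
    obtain l where l: "l \<in> spectrum (map_mat complex_of_real X)" "Re l = spectral_abscissa X"
      using spectral_abscissa_attained[OF X(1) d] .
    obtain i where i: "i < d" "Re l * x i \<le> (\<Sum>j<d. X $$ (i, j) * x j)"
      using metzler_weighted_gershgorin[OF X(1,2) xpos l(1)] .
    have "(\<Sum>j<d. X $$ (i, j) * x j) < (\<Sum>j<d. M $$ (i, j) * x j)"
      using X(3) i(1) xpos d by (intro sum_strict_mono mult_strict_right_mono) auto
    then have "Re l * x i < 0" using i Mx by simp
    then show ?thesis using xpos[OF i(1)] l(2) by (simp add: hurwitz_stable_def mult_less_0_iff)
  qed
  \<comment> \<open>Gershgorin with weights \<open>x\<close> bounds the abscissa above by 0, and
    \<open>x\<close> itself is an eigenvector for 0.\<close>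
  have eta: "spectral_abscissa M = 0"
  proof (rule antisym)
    obtain l where l: "l \<in> spectrum (map_mat complex_of_real M)" "Re l = spectral_abscissa M"
      using spectral_abscissa_attained[OF M d] .
    obtain i where "i < d" "Re l * x i \<le> (\<Sum>j<d. M $$ (i, j) * x j)"
      using metzler_weighted_gershgorin[OF M Mmetz xpos l(1)] .
    then show "spectral_abscissa M \<le> 0"
      using Mx xpos[of i] l(2) by (simp add: mult_le_0_iff)
    have "(\<Sum>j<d. complex_of_real (M $$ (i, j)) * of_real (x j)) = 0" if "i < d" for i
      using Mx[OF that] by (metis (mono_tags, lifting) of_real_0 of_real_mult of_real_sum sum.cong)
    then have "0 \<in> spectrum (map_mat complex_of_real M)"
      unfolding spectrum_of_real_iff[OF M] using d xpos[OF d]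
      by (intro exI[of _ "\<lambda>i. of_real (x i)"]) auto
    from Re_le_spectral_abscissa[OF M this] show "0 \<le> spectral_abscissa M" by simp
  qed
  have less_t: "max_norm (X - A) < c \<longleftrightarrow> (\<forall>i<d. \<forall>j<d. \<bar>X $$ (i, j) - A $$ (i, j)\<bar> < c)"
    if "X \<in> carrier_mat d d" for X c
    using max_norm_less_iff[of "X - A" d d c] that A(1) d by (simp add: minus_carrier_mat)
  have dist: "max_norm (M - A) = t"
  proof -
    have "max_norm (M - A) < c \<longleftrightarrow> t < c" for c using less_t[OF M] Mij t d by auto
    \<comment> \<open>The two instances exclude max_norm < t and t < max_norm respectively.\<close>
    from this[of t] this[of "max_norm (M - A)"] show ?thesis by simp
  qed
  \<comment> \<open>Assuming only a nonnegative abscissa covers the feasible sets of both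
    minimization problems.\<close>
  have far: "\<not> max_norm (X - A) < t"
    if X: "X \<in> carrier_mat d d" "metzler X" "spectral_abscissa X \<ge> 0" for X
  proof
    assume "max_norm (X - A) < t"
    then have "\<bar>X $$ (i, j) - A $$ (i, j)\<bar> < t" if "i < d" "j < d" for i j
      using less_t[OF X(1)] that by blast
    then have "X $$ (i, j) < M $$ (i, j)" if "i < d" "j < d" for i j
      using that Mij[OF that] by (fastforce simp: abs_less_iff)
    then have "hurwitz_stable X" using stab X by blast
    with X(3) show False by (simp add: hurwitz_stable_def)
  qed
  have "(\<forall>X \<in> carrier_mat d d. metzler X \<and> entrywise_less X M \<longrightarrow> hurwitz_stable X)"
    using stab M by (auto simp: entrywise_less_def)
  moreover have "is_arg_min (\<lambda>X. max_norm (X - A))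
      (\<lambda>X. X \<in> carrier_mat d d \<and> metzler X \<and> weakly_hurwitz_unstable X) M"
    using M Mmetz eta far dist by (auto simp: is_arg_min_def weakly_hurwitz_unstable_def)
  moreover have "is_arg_min (\<lambda>X. max_norm (X - A))
      (\<lambda>X. X \<in> carrier_mat d d \<and> metzler X \<and> spectral_abscissa X = 0) M"
    using M Mmetz eta far dist by (auto simp: is_arg_min_def)
  moreover have "max_norm (M - A) = 1 / (\<Sum>i<d. \<Sum>j<d. \<bar>inv_mat A $$ (i, j)\<bar>)"
    using dist tabs by (simp add: B_def)
  ultimately show ?thesis
    unfolding Let_def M_def[symmetric] by (intro conjI)
qed

end
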